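(* Let $m,n\ge 3$ be integers such that $q=2mn+1$ is a prime power and there exist two distinct odd primes $p$ and $p'$ with $p\mid m$ and $p'\mid n$. Then there exists a rank-one Heffter array H$(m,n)$ over $\mathbb{F}_q$.
   Context: A half-set of an additive group $G$ of odd order $2\ell+1$ is an $\ell$-subset $L$ with $L\cup -L=G\setminus\{0\}$. A Heffter array H$(m,n)$ over $\mathbb{F}_q$ (with $q=2mn+1$) is an $m\times n$ matrix over $\mathbb{F}_q$ whose entries form a half-set of the additive group of $\mathbb{F}_q$ and whose every row and column sums to $0$; it is rank-one if it has rank $1$ as a matrix over $\mathbb{F}_q$. (In the paper, a pair $(m,n)$ with $m,n>2$, $2mn+1$ a prime power and such primes $p,p'$ is called agreeable.) *)

theory Defs
  imports
    "Jordan_Normal_Form.DL_Rank"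
    "HOL-Number_Theory.Prime_Powers"
begin

(* CARD is 0 for an infinite type, so the cardinality condition also makes the group finite. *)
definition half_set :: "'a::group_add set \<Rightarrow> bool" where
  "half_set L \<longleftrightarrow>
     (\<exists>l. card (UNIV :: 'a set) = 2 * l + 1 \<and> card L = l \<and> L \<union> uminus ` L = UNIV - {0})"

(* The array has m * n positions and a half-set of a group of order 2mn+1 has exactly m * n
   elements, so the entries are automatically pairwise distinct. *)
definition heffter_array :: "nat \<Rightarrow> nat \<Rightarrow> 'a::field mat \<Rightarrow> bool" where
  "heffter_array m n A \<longleftrightarrow>
     card (UNIV :: 'a set) = 2 * m * n + 1 \<and>
     A \<in> carrier_mat m n \<and>
     half_set (elements_mat A) \<and>
     (\<forall>i<m. (\<Sum>j<n. A $$ (i, j)) = 0) \<and>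
     (\<forall>j<n. (\<Sum>i<m. A $$ (i, j)) = 0)"

(* The parameter m of vec_space.rank is the length of the columns. *)
definition rank_one_heffter_array :: "nat \<Rightarrow> nat \<Rightarrow> 'a::field mat \<Rightarrow> bool" where
  "rank_one_heffter_array m n A \<longleftrightarrow> heffter_array m n A \<and> vec_space.rank m A = 1"

end

theory Submission
  imports Defs "HOL-Algebra.Multiplicative_Group" "HOL-Number_Theory.Cong"
begin

text \<open>
  Write \<open>m = d p\<close>, \<open>n = e p'\<close> and let \<open>g\<close> generate the multiplicative group of the field. The
  subgroups of orders \<open>p\<close>, \<open>p'\<close> and \<open>2\<close> have a direct product \<open>K\<close> of order \<open>2 p p'\<close>, and the
  cyclic quotient by \<open>K\<close>, of order \<open>d e\<close>, is factored by the powers \<open>1, g, \<dots>, g ^ (d - 1)\<close> and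
  \<open>1, g ^ d, \<dots>, g ^ (d * (e - 1))\<close>. Hence every nonzero element is uniquely \<open>\<plusminus> a b\<close>, where \<open>a\<close>
  ranges over \<open>d\<close> cosets of the subgroup of order \<open>p\<close> and \<open>b\<close> over \<open>e\<close> cosets of the one of
  order \<open>p'\<close>. The matrix of the products \<open>a b\<close> has rank one, and its rows and columns sum to zero
  because every coset of a nontrivial finite multiplicative subgroup does.
\<close>

text \<open>If \<open>g ^ k = 1\<close> with \<open>k > 0\<close>, exponents reduce modulo
  \<open>k\<close>, so the powers below \<open>k\<close> exhaust the nonzero elements and
  \<open>k\<close> is at least their number. The pigeonhole principle supplies such a
  \<open>k\<close> that is no larger, which fixes the order of \<open>g\<close>.\<close>

lemma exists_primitive_element:
  obtains g :: "'a::{field, finite}" where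
    "g ^ (card (UNIV :: 'a set) - 1) = 1"
    and "\<And>x. x \<noteq> 0 \<Longrightarrow> \<exists>k. x = g ^ k"
    and "\<And>k. 0 < k \<Longrightarrow> k < card (UNIV :: 'a set) - 1 \<Longrightarrow> g ^ k \<noteq> 1"
proof -
  let ?N = "card (UNIV :: 'a set) - 1"
  obtain g :: 'a where g: "g \<noteq> 0" "UNIV - {0} = {g ^ i | i. i \<in> (UNIV :: nat set)}"
    using field.finite_field_mult_group_has_gen[OF class_field[where 'a = 'a]]
    by (auto simp: nat_pow_mult_of class_ring_simps)
  have gen: "\<exists>k. x = g ^ k" if "x \<noteq> 0" for x
    using g(2) that by blast
  have card: "card (UNIV - {0 :: 'a}) = ?N"
    by (simp add: card_Diff_singleton)
  have least: "?N \<le> k" if "0 < k" "g ^ k = 1" for k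
  proof -
    have "x \<in> (\<lambda>i. g ^ i) ` {..<k}" if "x \<noteq> 0" for x
    proof -
      obtain i where "x = g ^ i"
        using gen \<open>x \<noteq> 0\<close> by blast
      also have "\<dots> = (g ^ k) ^ (i div k) * g ^ (i mod k)"
        by (simp flip: power_mult power_add)
      finally show ?thesis
        using \<open>0 < k\<close> \<open>g ^ k = 1\<close> by auto
    qed
    then have "UNIV - {0} \<subseteq> (\<lambda>i. g ^ i) ` {..<k}"
      by blast
    then have "?N \<le> card ((\<lambda>i. g ^ i) ` {..<k})"
      unfolding card[symmetric] by (intro card_mono) auto
    also have "\<dots> \<le> k"
      using card_image_le[of "{..<k}" "\<lambda>i. g ^ i"] by simp
    finally show ?thesis .
  qed
  have "\<exists>k>0. k \<le> ?N \<and> g ^ k = 1"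
  proof -
    have "\<not> inj_on (\<lambda>i. g ^ i) {..?N}"
    proof
      assume "inj_on (\<lambda>i. g ^ i) {..?N}"
      then have "Suc ?N = card ((\<lambda>i. g ^ i) ` {..?N})"
        by (simp add: card_image)
      also have "\<dots> \<le> card (UNIV - {0 :: 'a})"
        using g(1) by (intro card_mono) auto
      finally show False
        using card by simp
    qed
    then obtain i j where ij: "i < j" "j \<le> ?N" "g ^ i = g ^ j"
      unfolding inj_on_def by (metis atMost_iff linorder_neqE_nat)
    then have "g ^ i * g ^ (j - i) = g ^ i * 1"
      by (metis le_add_diff_inverse less_imp_le mult_1_right power_add)
    then have "g ^ (j - i) = 1"
      using g(1) by simp
    then show ?thesis
      using ij by (intro exI[of _ "j - i"]) auto
  qed
  then have "g ^ ?N = 1"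
    using least by (metis le_antisym)
  then show thesis
    using that gen least by (meson not_le)
qed

text \<open>Product entries bound the rank by one from above; the column \<open>c\<close> is nonzero
  in row \<open>r\<close>, hence linearly independent by itself.\<close>

lemma rank_outer_product:
  fixes f g :: "nat \<Rightarrow> 'a::field"
  assumes "r < m" "c < n" "f r \<noteq> 0" "g c \<noteq> 0"
  shows "vec_space.rank m (mat m n (\<lambda>(i, j). f i * g j)) = 1"
proof -
  let ?A = "mat m n (\<lambda>(i, j). f i * g j)"
  interpret vec_space "TYPE('a)" m .
  have A: "?A \<in> carrier_mat m n"
    by simp
  have "rank ?A \<le> 1"
    by (rule rank_le_1_product_entries[OF A, of f g]) auto
  moreover have "1 \<le> rank ?A"
  proof -
    let ?v = "col ?A c"
    have v: "?v \<in> carrier_vec m" "?v \<in> set (cols ?A)"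
      using assms by (auto simp: cols_def)
    have "?v $ r \<noteq> 0"
      using assms by simp
    then have "?v \<noteq> 0\<^sub>v m"
      using assms(1) by auto
    then have "?v \<notin> span {}"
      using span_empty by simp
    then have "lin_indpt {?v}"
      using lin_dep_iff_in_span[of "{}" ?v] v(1) finite_lin_indpt2[of "{}"] by simp
    then show ?thesis
      using rank_ge_card_indpt[OF A, of "{?v}"] v by simp
  qed
  ultimately show ?thesis
    by simp
qed

text \<open>Writing \<open>i = t * d + s\<close> with \<open>s < d\<close> factors the sum into two
  geometric sums. The one over \<open>t\<close> equals \<open>(z ^ p - 1) / (z - 1)\<close> and
  vanishes.\<close>

lemma sum_root_of_unity_cosets:
  fixes x z :: "'a::field"
  assumes "z ^ p = 1" "z \<noteq> 1"
  shows "(\<Sum>i<p * d. x ^ (i mod d) * z ^ (i div d)) = 0"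
proof -
  have "(\<Sum>i<p * d. x ^ (i mod d) * z ^ (i div d))
      = (\<Sum>t<p. \<Sum>i = t * d..<t * d + d. x ^ (i mod d) * z ^ (i div d))"
    by (rule sum.nat_group[symmetric])
  also have "\<dots> = (\<Sum>t<p. \<Sum>i<d. x ^ i * z ^ t)"
  proof (rule sum.cong[OF refl])
    fix t
    have "(\<Sum>i = t * d..<t * d + d. x ^ (i mod d) * z ^ (i div d))
        = (\<Sum>i = 0..<d. x ^ ((t * d + i) mod d) * z ^ ((t * d + i) div d))"
      by (subst sum.atLeastLessThan_shift_0) simp
    also have "\<dots> = (\<Sum>i<d. x ^ i * z ^ t)"
      unfolding atLeast0LessThan by (rule sum.cong) auto
    finally show "(\<Sum>i = t * d..<t * d + d. x ^ (i mod d) * z ^ (i div d)) = (\<Sum>i<d. x ^ i * z ^ t)" .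
  qed
  also have "\<dots> = (\<Sum>i<d. x ^ i) * (\<Sum>t<p. z ^ t)"
    by (simp add: sum_distrib_left sum_distrib_right)
  also have "\<dots> = 0"
    using assms by (simp add: geometric_sum)
  finally show ?thesis .
qed

text \<open>This is the Chinese remainder theorem in the form that splits a cyclic group of order
  \<open>a * b\<close> into its subgroups of orders \<open>a\<close> and \<open>b\<close>. Each
  summand vanishes modulo one factor, so \<open>r\<close> is \<open>q / b\<close> modulo
  \<open>a\<close> and \<open>t\<close> is \<open>q / a\<close> modulo \<open>b\<close>.\<close>

lemma coprime_mod_prod_representation:
  fixes a b q :: nat
  assumes "coprime a b" "a > 0" "b > 0"
  obtains r t where "r < a" "t < b" "[q = r * b + t * a] (mod a * b)"
proof -
  obtain u where u: "[b * u = 1] (mod a)"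
    using cong_solve_coprime_nat[of b a] assms(1) by (auto simp: coprime_commute)
  obtain v where v: "[a * v = 1] (mod b)"
    using cong_solve_coprime_nat[of a b] assms(1) by auto
  define r t where "r = u * q mod a" and "t = v * q mod b"
  have "[r * b = (b * u) * q] (mod a)"
    unfolding r_def cong_def by (metis mod_mult_left_eq mult.assoc mult.commute)
  also have "[(b * u) * q = 1 * q] (mod a)"
    by (rule cong_mult[OF u cong_refl])
  finally have "[q = r * b + t * a] (mod a)"
    by (simp add: cong_def)
  moreover have "[q = r * b + t * a] (mod b)"
  proof -
    have "[t * a = (a * v) * q] (mod b)"
      unfolding t_def cong_def by (metis mod_mult_left_eq mult.assoc mult.commute)
    also have "[(a * v) * q = 1 * q] (mod b)"
      by (rule cong_mult[OF v cong_refl])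
    finally show ?thesis
      by (simp add: cong_def)
  qed
  ultimately have "[q = r * b + t * a] (mod a * b)"
    using assms(1) by (rule coprime_cong_mult_nat)
  moreover have "r < a" "t < b"
    using assms by (simp_all add: r_def t_def)
  ultimately show thesis
    using that by blast
qed

lemma power_eq_if_cong:
  fixes w :: "'a::monoid_mult"
  assumes "w ^ k = 1" "[i = j] (mod k)"
  shows "w ^ i = w ^ j"
proof -
  have "w ^ i = w ^ (i mod k)" for i
  proof -
    have "w ^ i = w ^ (k * (i div k) + i mod k)"
      by simp
    also have "\<dots> = w ^ (i mod k)"
      unfolding power_add power_mult assms(1) by simp
    finally show ?thesis .
  qed
  then show ?thesis
    using assms(2) by (metis cong_def)
qed

text \<open>A product set covering the nonzero elements up to sign has at least \<open>l\<close> elements, and \<open>l\<close>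
  index pairs give at most \<open>l\<close>; so covering alone makes the entries a half-set.\<close>

lemma half_set_if_covers:
  fixes L :: "'a::{field, finite} set"
  assumes "card (UNIV :: 'a set) = 2 * l + 1" "card L \<le> l" "0 \<notin> L"
    and "\<And>x. x \<noteq> 0 \<Longrightarrow> x \<in> L \<or> - x \<in> L"
  shows "half_set L"
proof -
  have un: "L \<union> uminus ` L = UNIV - {0}"
  proof
    show "L \<union> uminus ` L \<subseteq> UNIV - {0}"
      using assms(3) by auto
    show "UNIV - {0} \<subseteq> L \<union> uminus ` L"
    proof
      fix x :: 'a assume "x \<in> UNIV - {0}"
      then have "x \<in> L \<or> - x \<in> L"
        using assms(4) by simp
      then show "x \<in> L \<union> uminus ` L"
        using image_eqI[of x uminus "- x" L] by auto
    qed
  qed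
  have "2 * l = card (L \<union> uminus ` L)"
    unfolding un using assms(1) by (simp add: card_Diff_singleton)
  also have "\<dots> \<le> card L + card L"
    using card_Un_le[of L "uminus ` L"] card_image_le[of L uminus] by simp
  finally have "card L = l"
    using assms(2) by simp
  then show ?thesis
    unfolding half_set_def using assms(1) un by blast
qed

lemma card_elements_mat_le: "card (elements_mat A) \<le> dim_row A * dim_col A"
proof -
  have "elements_mat A = (\<lambda>p. A $$ p) ` ({..<dim_row A} \<times> {..<dim_col A})"
    unfolding elements_mat_def by force
  then show ?thesis
    using card_image_le[of "{..<dim_row A} \<times> {..<dim_col A}" "\<lambda>p. A $$ p"]
    by (simp add: card_cartesian_product)
qed

text \<open>Division of \<open>k\<close> by \<open>d * e\<close> leaves a remainder
  \<open>s\<close>, which picks the two coset representatives, and a power of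
  \<open>h = g ^ (d * e)\<close>. Up to sign that power is a power of \<open>h\<^sup>2\<close>, and
  since \<open>(h\<^sup>2) ^ (p * p') = 1\<close> it splits into a power for \<open>p\<close> and
  one for \<open>p'\<close>.\<close>

lemma signed_coset_factorization:
  fixes g :: "'a::field" and d e p p' k :: nat
  assumes half: "g ^ (d * e * (p * p')) = - 1"
    and "odd p" "odd p'" "coprime p p'" "d > 0" "e > 0"
  obtains i j where "i < p * d" "j < p' * e"
    "g ^ k = g ^ (i mod d) * (g ^ (2 * d * e * p')) ^ (i div d)
             * ((g ^ d) ^ (j mod e) * (g ^ (2 * d * e * p)) ^ (j div e))
     \<or> - (g ^ k) = g ^ (i mod d) * (g ^ (2 * d * e * p')) ^ (i div d)
             * ((g ^ d) ^ (j mod e) * (g ^ (2 * d * e * p)) ^ (j div e))"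
proof -
  define h where "h = g ^ (d * e)"
  have pos: "p > 0" "p' > 0"
    using assms(2,3) by (auto elim: oddE)
  have hhalf: "h ^ (p * p') = - 1"
    using half by (simp add: h_def power_mult)
  have one: "(h\<^sup>2) ^ (p * p') = 1"
    by (simp add: power_mult[symmetric] mult.commute[of 2] power_mult[of h "p * p'" 2] hhalf)
  define q where "q = k div (d * e)"
  define s where "s = k mod (d * e)"
  have gk: "g ^ k = g ^ s * h ^ q"
    by (simp add: h_def q_def s_def flip: power_mult power_add)
  \<comment> \<open>Multiplication by \<open>h ^ (p * p') = - 1\<close> changes the sign and, as
    \<open>p * p'\<close> is odd, also the parity of the exponent.\<close>
  have "\<exists>q'. h ^ q = (h\<^sup>2) ^ q' \<or> - (h ^ q) = (h\<^sup>2) ^ q'"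
  proof (cases "even q")
    case True
    then show ?thesis
      by (metis evenE power_mult)
  next
    case False
    with assms(2,3) have "even (q + p * p')"
      by simp
    then obtain q' where "q + p * p' = 2 * q'"
      by (rule evenE)
    then have "(h\<^sup>2) ^ q' = h ^ q * h ^ (p * p')"
      by (simp flip: power_mult power_add)
    then show ?thesis
      using hhalf by (intro exI[of _ q']) simp
  qed
  then obtain q' where q': "h ^ q = (h\<^sup>2) ^ q' \<or> - (h ^ q) = (h\<^sup>2) ^ q'"
    by blast
  obtain r t where rt: "r < p" "t < p'" "[q' = r * p' + t * p] (mod p * p')"
    using coprime_mod_prod_representation[OF assms(4) pos] .
  have hq': "(h\<^sup>2) ^ q' = (g ^ (2 * d * e * p')) ^ r * (g ^ (2 * d * e * p)) ^ t"
    unfolding power_eq_if_cong[OF one rt(3)]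
    by (simp add: h_def power_add mult_ac flip: power_mult)
  \<comment> \<open>In each index the high digit is the exponent in the subgroup and the low digit
    names the coset; the low digits \<open>s mod d\<close> and \<open>s div d\<close> together
    recover \<open>s\<close>.\<close>
  define i where "i = r * d + s mod d"
  define j where "j = t * e + s div d"
  have "s < d * e"
    using assms(5,6) by (simp add: s_def)
  then have sd: "s div d < e"
    by (simp add: less_mult_imp_div_less mult.commute)
  have i: "i mod d = s mod d" "i div d = r" and j: "j mod e = s div d" "j div e = t"
    using assms(5,6) sd by (simp_all add: i_def j_def)
  have "i < p * d"
    using i(2) rt(1) assms(5) by (metis div_less_iff_less_mult)
  moreover have "j < p' * e"
    using j(2) rt(2) assms(6) by (metis div_less_iff_less_mult)
  moreover have "g ^ (s mod d) * (g ^ d) ^ (s div d) = g ^ s"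
    by (simp flip: power_mult power_add)
  then have "g ^ (i mod d) * (g ^ (2 * d * e * p')) ^ (i div d)
             * ((g ^ d) ^ (j mod e) * (g ^ (2 * d * e * p)) ^ (j div e)) = g ^ s * (h\<^sup>2) ^ q'"
    unfolding i j hq' by (metis mult.assoc mult.left_commute)
  moreover have "g ^ k = g ^ s * (h\<^sup>2) ^ q' \<or> - (g ^ k) = g ^ s * (h\<^sup>2) ^ q'"
    using q' unfolding gk by (metis mult_minus_right)
  ultimately show thesis
    using that by metis
qed

theorem theorem2:
  fixes m n :: nat
  assumes "m \<ge> 3" and "n \<ge> 3"
    and "primepow (2 * m * n + 1)"
    and "card (UNIV :: 'a::{field, finite} set) = 2 * m * n + 1"
    and "\<exists>p p' :: nat. prime p \<and> prime p' \<and> odd p \<and> odd p' \<and> p \<noteq> p' \<and> p dvd m \<and> p' dvd n"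
  shows "\<exists>A :: 'a mat. rank_one_heffter_array m n A"
proof -
  obtain p p' :: nat where pp: "prime p" "prime p'" "odd p" "odd p'" "p \<noteq> p'" "p dvd m" "p' dvd n"
    using assms(5) by blast
  obtain d e where m: "m = p * d" and n: "n = p' * e"
    using pp by (auto elim!: dvdE)
  have pos: "d > 0" "e > 0" "p > 1" "p' > 1" "m > 0" "n > 0"
    using assms(1,2) m n prime_gt_1_nat[OF pp(1)] prime_gt_1_nat[OF pp(2)] by (auto intro: gr0I)
  obtain g :: 'a where one: "g ^ (2 * m * n) = 1" and gen: "\<And>x. x \<noteq> 0 \<Longrightarrow> \<exists>k. x = g ^ k"
    and ord: "\<And>k. 0 < k \<Longrightarrow> k < 2 * m * n \<Longrightarrow> g ^ k \<noteq> 1"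
    using exists_primitive_element[where 'a = 'a] unfolding assms(4) by auto
  have g0: "g \<noteq> 0"
    using one pos by (auto simp: power_0_left)
  \<comment> \<open>A field has no square roots of one besides \<open>1\<close> and
    \<open>- 1\<close>, and the order of \<open>g\<close> rules out \<open>1\<close>.\<close>
  have "(g ^ (m * n))\<^sup>2 = 1"
    using one by (simp add: mult_ac flip: power_mult)
  moreover have "g ^ (m * n) \<noteq> 1"
    using pos by (intro ord) auto
  ultimately have half: "g ^ (d * e * (p * p')) = - 1"
    using power2_eq_1_iff[of "g ^ (m * n)"] by (simp add: m n mult_ac)
  \<comment> \<open>The exponents are \<open>2 * m * n\<close> divided by \<open>p\<close> and by
    \<open>p'\<close>, so \<open>z\<close> and \<open>w\<close> generate the subgroups of orders
    \<open>p\<close> and \<open>p'\<close>.\<close>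
  define z where "z = g ^ (2 * d * e * p')"
  define w where "w = g ^ (2 * d * e * p)"
  have z: "z ^ p = 1" "z \<noteq> 1"
  proof -
    show "z ^ p = 1"
      using one by (simp add: z_def m n mult_ac flip: power_mult)
    have "1 * (2 * d * e * p') < p * (2 * d * e * p')"
      using pos by (intro mult_strict_right_mono) auto
    then show "z \<noteq> 1"
      unfolding z_def using pos by (intro ord) (auto simp: m n mult_ac)
  qed
  have w: "w ^ p' = 1" "w \<noteq> 1"
  proof -
    show "w ^ p' = 1"
      using one by (simp add: w_def m n mult_ac flip: power_mult)
    have "1 * (2 * d * e * p) < p' * (2 * d * e * p)"
      using pos by (intro mult_strict_right_mono) auto
    then show "w \<noteq> 1"
      unfolding w_def using pos by (intro ord) (auto simp: m n mult_ac)
  qed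
  \<comment> \<open>\<open>a\<close> lists the \<open>d\<close> cosets of the powers of
    \<open>z\<close>, and \<open>b\<close> the \<open>e\<close> cosets of the powers of
    \<open>w\<close>, one element per index.\<close>
  define a where "a = (\<lambda>i. g ^ (i mod d) * z ^ (i div d))"
  define b where "b = (\<lambda>j. (g ^ d) ^ (j mod e) * w ^ (j div e))"
  define A where "A = mat m n (\<lambda>(i, j). a i * b j)"
  have A: "A \<in> carrier_mat m n" "\<And>i j. i < m \<Longrightarrow> j < n \<Longrightarrow> A $$ (i, j) = a i * b j"
    by (simp_all add: A_def)
  have nz: "a i \<noteq> 0" "b j \<noteq> 0" for i j
    using g0 by (simp_all add: a_def b_def z_def w_def)
  have "half_set (elements_mat A)"
  proof (rule half_set_if_covers)
    show "card (UNIV :: 'a set) = 2 * (m * n) + 1"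
      using assms(4) by simp
    show "card (elements_mat A) \<le> m * n"
      using card_elements_mat_le[of A] A(1) by simp
    show "0 \<notin> elements_mat A"
      using A nz by (auto dest!: elements_matD)
  next
    fix x :: 'a assume "x \<noteq> 0"
    then obtain k where k: "x = g ^ k"
      using gen by blast
    \<comment> \<open>Distinctness of the two primes enters here.\<close>
    have "coprime p p'"
      using pp by (simp add: primes_coprime)
    then obtain i j where "i < m" "j < n" and "x = a i * b j \<or> - x = a i * b j"
      using signed_coset_factorization[OF half pp(3,4) _ pos(1,2), of k]
      unfolding k a_def b_def z_def w_def m n by metis
    then show "x \<in> elements_mat A \<or> - x \<in> elements_mat A"
      using elements_matI[OF A(1)] A(2) by metis
  qed
  \<comment> \<open>Every row is a multiple of \<open>b\<close> and every column a multiple of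
    \<open>a\<close>, so the coset sums for \<open>w\<close> and \<open>z\<close> settle
    both.\<close>
  moreover have "(\<Sum>j<n. A $$ (i, j)) = 0" if "i < m" for i
  proof -
    have "(\<Sum>j<n. A $$ (i, j)) = a i * (\<Sum>j<n. b j)"
      using that A(2) by (simp add: sum_distrib_left)
    then show ?thesis
      using sum_root_of_unity_cosets[OF w] by (simp add: b_def n)
  qed
  moreover have "(\<Sum>i<m. A $$ (i, j)) = 0" if "j < n" for j
  proof -
    have "(\<Sum>i<m. A $$ (i, j)) = (\<Sum>i<m. a i) * b j"
      using that A(2) by (simp add: sum_distrib_right)
    then show ?thesis
      using sum_root_of_unity_cosets[OF z] by (simp add: a_def m)
  qed
  moreover have "vec_space.rank m A = 1"
    unfolding A_def using rank_outer_product[of 0 m 0 n a b] pos nz by simp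
  ultimately show ?thesis
    unfolding rank_one_heffter_array_def heffter_array_def using A(1) assms(4) by blast
qed

end
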